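(* For any ideal $I$ of a skew brace $A$, $$[I,A]_{\mathsf{Huq}}=[I,A]_{\mathsf{Ab}}.$$
   Context: A skew brace is a triple $(A,+,\circ)$ where $(A,+)$ and $(A,\circ)$ are groups such that $a\circ(b+c)=a\circ b-a+a\circ c$ for all $a,b,c\in A$; $a'$ denotes the inverse of $a$ in $(A,\circ)$. Put $a*b=-a+a\circ b-b$, $[a,b]_+=a+b-a-b$ and $[a,b]_\circ=a\circ b\circ a'\circ b'$. An ideal of $A$ is a normal subgroup $I$ of $(A,+)$ with $a*x, x*a\in I$ for all $a\in A$, $x\in I$; an ideal is in particular a skew brace under the restricted operations. For an ideal $I$ of $A$, $[I,A]_{\mathsf{Ab}}$ is the subgroup of $(A,+)$ generated by $\{[i,b]_+,\ i*b,\ [i,b]_\circ\mid i\in I,\ b\in A\}$ (it is an ideal of $A$). The Huq commutator $[I,A]_{\mathsf{Huq}}$ is the smallest ideal $J$ of $A$ such that the composite map $I\times A\to A\to A/J$, $(i,a)\mapsto \overline{i+a}$, is a homomorphism of skew braces, where $I\times A$ is the product skew brace and $A\to A/J$ is the canonical quotient. *)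

theory Defs
  imports "HOL-Algebra.Algebra"
begin

text \<open>
  A skew brace is carried by the two-operation record type of \<open>HOL-Algebra\<close>, used here only as a
  signature: \<open>\<oplus>\<close> (group \<open>add_monoid A\<close>, inverse \<open>\<ominus> a\<close>) is the additive operation \<open>+\<close>, not assumed
  commutative, and \<open>\<otimes>\<close> (group \<open>A\<close>, inverse \<open>inv a\<close>) is the circle operation; \<open>inv a\<close> is the
  element written \<open>a'\<close> in the literature. That \<open>\<zero> = \<one>\<close> follows from the axioms.
\<close>

locale skew_brace = group A for A :: "('a, 'm) ring_scheme" (structure) +
  assumes a_group: "group (add_monoid A)"
    and circ_add: "\<lbrakk>a \<in> carrier A; b \<in> carrier A; c \<in> carrier A\<rbrakk>
      \<Longrightarrow> a \<otimes> (b \<oplus> c) = a \<otimes> b \<ominus> a \<oplus> a \<otimes> c"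

definition sb_star :: "('a, 'm) ring_scheme \<Rightarrow> 'a \<Rightarrow> 'a \<Rightarrow> 'a"
  where "sb_star A a b = (\<ominus>\<^bsub>A\<^esub> a) \<oplus>\<^bsub>A\<^esub> (a \<otimes>\<^bsub>A\<^esub> b) \<ominus>\<^bsub>A\<^esub> b"

definition add_commutator :: "('a, 'm) ring_scheme \<Rightarrow> 'a \<Rightarrow> 'a \<Rightarrow> 'a"
  where "add_commutator A a b = a \<oplus>\<^bsub>A\<^esub> b \<ominus>\<^bsub>A\<^esub> a \<ominus>\<^bsub>A\<^esub> b"

definition circ_commutator :: "('a, 'm) ring_scheme \<Rightarrow> 'a \<Rightarrow> 'a \<Rightarrow> 'a"
  where "circ_commutator A a b = a \<otimes>\<^bsub>A\<^esub> b \<otimes>\<^bsub>A\<^esub> inv\<^bsub>A\<^esub> a \<otimes>\<^bsub>A\<^esub> inv\<^bsub>A\<^esub> b"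

definition sb_ideal :: "'a set \<Rightarrow> ('a, 'm) ring_scheme \<Rightarrow> bool"
  where "sb_ideal I A \<longleftrightarrow> I \<lhd> add_monoid A \<and>
    (\<forall>a\<in>carrier A. \<forall>x\<in>I. sb_star A a x \<in> I \<and> sb_star A x a \<in> I)"

definition skew_brace_hom :: "('a, 'm) ring_scheme \<Rightarrow> ('b, 'n) ring_scheme \<Rightarrow> ('a \<Rightarrow> 'b) set"
  where "skew_brace_hom A B = hom (add_monoid A) (add_monoid B) \<inter> hom A B"

definition Ab_commutator :: "('a, 'm) ring_scheme \<Rightarrow> 'a set \<Rightarrow> 'a set"
  where "Ab_commutator A I = generate (add_monoid A)
    (\<Union>i\<in>I. \<Union>b\<in>carrier A. {add_commutator A i b, sb_star A i b, circ_commutator A i b})"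

text \<open>
  \<open>RDirProd\<close> is the componentwise product and \<open>A Quot J\<close> the quotient \<open>A/J\<close> on the additive cosets
  \<open>J +> a\<close>; both are defined in the library for arbitrary records with two operations. The lemma
  \<open>coset_circ\<close> below shows that the second operation of \<open>A Quot J\<close> is the expected one.
\<close>

definition Huq_central :: "('a, 'm) ring_scheme \<Rightarrow> 'a set \<Rightarrow> 'a set \<Rightarrow> bool"
  where "Huq_central A I J \<longleftrightarrow> sb_ideal J A \<and>
    (\<lambda>(i, a). J +>\<^bsub>A\<^esub> (i \<oplus>\<^bsub>A\<^esub> a)) \<in> skew_brace_hom (RDirProd (A\<lparr>carrier := I\<rparr>) A) (A Quot J)"

text \<open>
  The least element with respect to inclusion; it exists by \<open>Huq_commutator_least\<close> below.
\<close>

definition Huq_commutator :: "('a, 'm) ring_scheme \<Rightarrow> 'a set \<Rightarrow> 'a set"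
  where "Huq_commutator A I = (LEAST J. Huq_central A I J)"

context skew_brace
begin

sublocale add: group "add_monoid A"
  rewrites "carrier (add_monoid A) = carrier A"
    and "monoid.mult (add_monoid A) = (\<oplus>)"
    and "monoid.one (add_monoid A) = \<zero>"
    and "m_inv (add_monoid A) = a_inv A"
    and "r_coset (add_monoid A) = a_r_coset A"
    and "l_coset (add_monoid A) = a_l_coset A"
  by (rule a_group) (auto simp: a_inv_def a_r_coset_def a_l_coset_def)

lemma lambda_closed:
  assumes J: "sb_ideal J A" and a: "a \<in> carrier A" and x: "x \<in> J"
  shows "\<ominus> a \<oplus> a \<otimes> x \<in> J"
proof -
  have sub: "subgroup J (add_monoid A)"
    using J normal_imp_subgroup by (auto simp: sb_ideal_def)
  have xc: "x \<in> carrier A" using subgroup.mem_carrier[OF sub x] by simp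
  have "sb_star A a x \<in> J" using J a x by (auto simp: sb_ideal_def)
  then have "sb_star A a x \<oplus> x \<in> J" using subgroup.m_closed[OF sub _ x] by simp
  moreover have "sb_star A a x \<oplus> x = \<ominus> a \<oplus> a \<otimes> x"
    using a xc by (simp add: sb_star_def a_minus_def add.m_assoc)
  ultimately show ?thesis by simp
qed

lemma coset_sym:
  assumes J: "sb_ideal J A" and a: "a \<in> carrier A"
  shows "J +> a = a <+ J"
  using J a normal.coset_eq[of J "add_monoid A"]
  by (auto simp: sb_ideal_def a_r_coset_def a_l_coset_def)

lemma circ_coset_eq:
  assumes J: "sb_ideal J A" and a: "a \<in> carrier A"
  shows "J +> a = a <# J"
proof -
  have sub: "subgroup J (add_monoid A)"
    using J normal_imp_subgroup by (auto simp: sb_ideal_def)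
  have Jc: "\<And>x. x \<in> J \<Longrightarrow> x \<in> carrier A" using subgroup.mem_carrier[OF sub] by simp
  have "a <# J = a <+ J"
  proof
    show "a <# J \<subseteq> a <+ J"
    proof
      fix y assume "y \<in> a <# J"
      then obtain x where x: "x \<in> J" "y = a \<otimes> x" by (auto simp: l_coset_def)
      have "y = a \<oplus> (\<ominus> a \<oplus> a \<otimes> x)"
        using x a Jc by (simp add: add.m_assoc[symmetric])
      then show "y \<in> a <+ J" using lambda_closed[OF J a x(1)] by (auto simp: a_l_coset_def')
    qed
    show "a <+ J \<subseteq> a <# J"
    proof
      fix y assume "y \<in> a <+ J"
      then obtain x where x: "x \<in> J" "y = a \<oplus> x" by (auto simp: a_l_coset_def')
      have xc: "x \<in> carrier A" by (rule Jc[OF x(1)])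
      have z: "a \<otimes> \<zero> = a"
      proof -
        have "a \<otimes> \<zero> = a \<otimes> \<zero> \<ominus> a \<oplus> a \<otimes> \<zero>"
          using circ_add[OF a add.one_closed add.one_closed] by simp
        then have "a \<otimes> \<zero> \<ominus> a = \<zero>"
          using a add.r_cancel_one'[of "a \<otimes> \<zero>" "a \<otimes> \<zero> \<ominus> a"] by (simp add: a_minus_def)
        then show ?thesis using a add.inv_equality[of "a \<otimes> \<zero>" "\<ominus> a"]
          by (simp add: a_minus_def)
      qed
      have zo: "\<zero> = \<one>" using z a l_cancel_one[of a \<zero>] by simp
      have "inv a \<otimes> y = inv a \<otimes> a \<ominus> inv a \<oplus> inv a \<otimes> x"
        using x xc a circ_add[of "inv a" a x] by simp
      also have "\<dots> = \<ominus> (inv a) \<oplus> inv a \<otimes> x" using a xc by (simp add: zo[symmetric] a_minus_def)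
      finally have "inv a \<otimes> y \<in> J" using lambda_closed[OF J _ x(1), of "inv a"] a by simp
      moreover have "y = a \<otimes> (inv a \<otimes> y)" using a x xc by (simp add: m_assoc[symmetric])
      ultimately show "y \<in> a <# J" by (auto simp: l_coset_def)
    qed
  qed
  with coset_sym[OF J a] show ?thesis by simp
qed

lemma coset_eq_iff:
  assumes J: "sb_ideal J A" and a: "a \<in> carrier A" and b: "b \<in> carrier A"
  shows "J +> a = J +> b \<longleftrightarrow> a \<ominus> b \<in> J"
proof -
  have sub: "subgroup J (add_monoid A)"
    using J normal_imp_subgroup by (auto simp: sb_ideal_def)
  have "J +> a = J +> b \<longleftrightarrow> a \<in> J +> b"
    using add.repr_independence[OF _ b sub, of a] add.rcos_self[OF a sub] by auto
  also have "\<dots> \<longleftrightarrow> a \<ominus> b \<in> J"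
    using subgroup.rcos_module[OF sub a_group, of b a] a b
    by (simp add: a_r_coset_def a_minus_def a_inv_def)
  finally show ?thesis .
qed

lemma circ_mem:
  assumes J: "sb_ideal J A" and x: "x \<in> J" and y: "y \<in> J"
  shows "x \<otimes> y \<in> J"
proof -
  have sub: "subgroup J (add_monoid A)"
    using J normal_imp_subgroup by (auto simp: sb_ideal_def)
  have Jc: "\<And>x. x \<in> J \<Longrightarrow> x \<in> carrier A" using subgroup.mem_carrier[OF sub] by simp
  have "x \<oplus> (\<ominus> x \<oplus> x \<otimes> y) \<in> J"
    using subgroup.m_closed[OF sub x lambda_closed[OF J Jc[OF x] y]] by simp
  then show ?thesis using Jc[OF x] Jc[OF y] by (simp add: add.m_assoc[symmetric])
qed

lemma coset_circ:
  assumes J: "sb_ideal J A" and a: "a \<in> carrier A" and b: "b \<in> carrier A"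
  shows "[mod J:] (J +> a) \<Otimes> (J +> b) = J +> (a \<otimes> b)"
proof -
  have sub: "subgroup J (add_monoid A)"
    using J normal_imp_subgroup by (auto simp: sb_ideal_def)
  have Jc: "\<And>x. x \<in> J \<Longrightarrow> x \<in> carrier A" using subgroup.mem_carrier[OF sub] by simp
  have key: "J +> (u \<otimes> v) = J +> (a \<otimes> b)" if u: "u \<in> J +> a" and v: "v \<in> J +> b" for u v
  proof -
    from u circ_coset_eq[OF J a] obtain x where x: "x \<in> J" "u = a \<otimes> x"
      by (auto simp: l_coset_def)
    from v circ_coset_eq[OF J b] obtain y where y: "y \<in> J" "v = b \<otimes> y"
      by (auto simp: l_coset_def)
    have xc: "x \<in> carrier A" and yc: "y \<in> carrier A" using Jc x y by auto
    have "x \<otimes> b = x \<oplus> (sb_star A x b \<oplus> b)"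
      using xc b by (simp add: sb_star_def a_minus_def add.m_assoc)
        (simp add: add.m_assoc[symmetric])
    also have "\<dots> = (x \<oplus> sb_star A x b) \<oplus> b"
      using xc b by (simp add: sb_star_def a_minus_def add.m_assoc)
    finally have "x \<otimes> b = (x \<oplus> sb_star A x b) \<oplus> b" .
    moreover have "x \<oplus> sb_star A x b \<in> J"
      using subgroup.m_closed[OF sub x(1), of "sb_star A x b"] J b x(1)
      by (auto simp: sb_ideal_def)
    ultimately have "x \<otimes> b \<in> J +> b" by (auto simp: a_r_coset_def')
    then obtain z where z: "z \<in> J" "x \<otimes> b = b \<otimes> z"
      using circ_coset_eq[OF J b] by (auto simp: l_coset_def)
    have zc: "z \<in> carrier A" using Jc z by auto
    have "u \<otimes> v = a \<otimes> ((x \<otimes> b) \<otimes> y)" using x y a b xc yc by (simp add: m_assoc)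
    also have "\<dots> = (a \<otimes> b) \<otimes> (z \<otimes> y)" using z a b yc zc by (simp add: m_assoc)
    finally have "u \<otimes> v \<in> (a \<otimes> b) <# J"
      using circ_mem[OF J z(1) y(1)] by (auto simp: l_coset_def)
    then have "u \<otimes> v \<in> J +> (a \<otimes> b)" using circ_coset_eq[OF J, of "a \<otimes> b"] a b by simp
    then show ?thesis using add.repr_independence[OF _ _ sub, of "u \<otimes> v" "a \<otimes> b"] a b by simp
  qed
  have "a \<in> J +> a" "b \<in> J +> b" using add.rcos_self[OF _ sub] a b by auto
  with key show ?thesis unfolding rcoset_mult_def by blast
qed

lemma Huq_central_iff:
  assumes I: "I \<subseteq> carrier A"
  shows "Huq_central A I J \<longleftrightarrow> sb_ideal J A \<and>
    (\<forall>i\<in>I. \<forall>j\<in>I. \<forall>a\<in>carrier A. \<forall>b\<in>carrier A.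
      (i \<oplus> j \<oplus> (a \<oplus> b)) \<ominus> ((i \<oplus> a) \<oplus> (j \<oplus> b)) \<in> J \<and>
      (i \<otimes> j \<oplus> a \<otimes> b) \<ominus> ((i \<oplus> a) \<otimes> (j \<oplus> b)) \<in> J)"
proof (cases "sb_ideal J A")
  case J: True
  have N: "J \<lhd> add_monoid A" using J by (simp add: sb_ideal_def)
  have Ic: "\<And>i. i \<in> I \<Longrightarrow> i \<in> carrier A" using I by auto
  have sum: "(J +> x) <+> (J +> y) = J +> (x \<oplus> y)" if "x \<in> carrier A" "y \<in> carrier A" for x y
    using normal.rcos_sum[OF N, of x y] that by (simp add: a_r_coset_def set_add_def)
  have "J +> x \<in> a_rcosets J" if "x \<in> carrier A" for x
    using that by (auto simp: A_RCOSETS_def')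
  then show ?thesis using J Ic
    by (auto simp: Huq_central_def skew_brace_hom_def hom_def RDirProd_carrier RDirProd_add_monoid
        FactRing_def DirProd_def sum coset_circ coset_eq_iff RDirProd_def monoid.defs)
next
  case False
  then show ?thesis by (simp add: Huq_central_def)
qed

lemma sb_ideal_carrier: "sb_ideal (carrier A) A"
  unfolding sb_ideal_def add.normal_inv_iff
  using add.subgroup_self by (auto simp: sb_star_def a_minus_def)

lemma sb_ideal_Inter:
  assumes "\<J> \<noteq> {}" and "\<And>J. J \<in> \<J> \<Longrightarrow> sb_ideal J A"
  shows "sb_ideal (\<Inter>\<J>) A"
  using assms add.subgroups_Inter[of \<J>] unfolding sb_ideal_def add.normal_inv_iff by auto

lemma Huq_commutator_least:
  assumes I: "sb_ideal I A"
  shows "Huq_central A I (Huq_commutator A I)"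
    and "Huq_central A I J \<Longrightarrow> Huq_commutator A I \<subseteq> J"
proof -
  have sub: "I \<subseteq> carrier A"
    using I normal_imp_subgroup subgroup.subset by (fastforce simp: sb_ideal_def)
  let ?J = "\<Inter>{J. Huq_central A I J}"
  have "Huq_central A I (carrier A)"
    using sub sb_ideal_carrier by (auto simp: Huq_central_iff[OF sub] a_minus_def subsetD)
  then have ne: "{J. Huq_central A I J} \<noteq> {}" by auto
  have "sb_ideal ?J A" by (rule sb_ideal_Inter[OF ne]) (simp add: Huq_central_def)
  then have c: "Huq_central A I ?J" by (subst Huq_central_iff[OF sub]) (simp add: Huq_central_iff[OF sub])
  then have eq: "Huq_commutator A I = ?J"
    unfolding Huq_commutator_def by (intro Least_equality) auto
  show "Huq_central A I (Huq_commutator A I)" using c eq by simp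
  show "Huq_central A I J \<Longrightarrow> Huq_commutator A I \<subseteq> J" using eq by auto
qed

end

end

theory Submission
  imports Defs
begin

text \<open>
  Modulo an ideal \<open>J\<close>, the Huq condition says that \<open>i + a = a + i\<close> and
  \<open>i \<circ> j + a \<circ> b = (i + a) \<circ> (j + b)\<close> for \<open>i, j \<in> I\<close>. Setting some of the variables to \<open>0\<close> gives
  \<open>i \<circ> a = i + a = a + i = a \<circ> i\<close>, that is, all generators of \<open>[I,A]\<^sub>A\<^sub>b\<close> lie in \<open>J\<close>. Conversely
  these identities give \<open>i \<circ> j + a \<circ> b = i \<circ> j \<circ> a \<circ> b = i \<circ> a \<circ> j \<circ> b = (i + a) \<circ> (j + b)\<close>. It
  remains to see that \<open>K = [I,A]\<^sub>A\<^sub>b\<close> is an ideal. As \<open>K \<subseteq> I\<close>, the elements \<open>[x,a]\<^sub>+\<close> and \<open>x * a\<close> with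
  \<open>x \<in> K\<close> are among the generators of \<open>K\<close>; writing \<open>c = [x,a]\<^sub>\<circ> \<in> K\<close>, the identity
  \<open>c \<circ> (a \<circ> x) = x \<circ> a\<close> yields \<open>a * x \<in> K\<close>.
\<close>

context skew_brace
begin

lemma add_inv_cancel [simp]:
  assumes "a \<in> carrier A" "b \<in> carrier A"
  shows "a \<oplus> (\<ominus> a \<oplus> b) = b" "\<ominus> a \<oplus> (a \<oplus> b) = b"
  using assms by (simp_all add: add.m_assoc[symmetric])

lemma circ_inv_cancel [simp]:
  assumes "a \<in> carrier A" "b \<in> carrier A"
  shows "a \<otimes> (inv a \<otimes> b) = b" "inv a \<otimes> (a \<otimes> b) = b"
  using assms by (simp_all add: m_assoc[symmetric])

text \<open>Distributivity at zero makes \<open>\<zero> \<otimes> \<zero>\<close> an additive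
  idempotent, hence zero; then \<open>\<zero>\<close> is idempotent in the circle group, hence its
  identity.\<close>

lemma zero_eq_one: "\<zero> = \<one>"
proof -
  have "\<zero> \<otimes> \<zero> = \<zero> \<otimes> \<zero> \<oplus> \<zero> \<otimes> \<zero>"
    using circ_add[of \<zero> \<zero> \<zero>] by (simp add: a_minus_def)
  then have "\<zero> \<otimes> \<zero> = \<zero>"
    using add.r_cancel_one'[of "\<zero> \<otimes> \<zero>" "\<zero> \<otimes> \<zero>"] by simp
  then show ?thesis using l_cancel_one[of \<zero> \<zero>] by simp
qed

lemma commutators_closed [simp]:
  assumes "a \<in> carrier A" "b \<in> carrier A"
  shows "add_commutator A a b \<in> carrier A" "sb_star A a b \<in> carrier A"
    "circ_commutator A a b \<in> carrier A"
  using assms by (simp_all add: add_commutator_def sb_star_def circ_commutator_def a_minus_def)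

lemma circ_eq_add_star:
  assumes "a \<in> carrier A" "b \<in> carrier A"
  shows "a \<otimes> b = a \<oplus> sb_star A a b \<oplus> b"
  using assms by (simp add: sb_star_def a_minus_def add.m_assoc)

lemma circ_commutator_circ:
  assumes "a \<in> carrier A" "b \<in> carrier A"
  shows "circ_commutator A a b \<otimes> (b \<otimes> a) = a \<otimes> b"
  using assms by (simp add: circ_commutator_def m_assoc)

lemma sb_ideal_subgroup: "sb_ideal J A \<Longrightarrow> subgroup J (add_monoid A)"
  by (simp add: sb_ideal_def normal_imp_subgroup)

lemma sb_ideal_subset: "sb_ideal J A \<Longrightarrow> J \<subseteq> carrier A"
  using subgroup.subset[OF sb_ideal_subgroup] by simp

lemma coset_add:
  assumes "sb_ideal J A" "x \<in> carrier A" "y \<in> carrier A"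
  shows "(J +> x) <+> (J +> y) = J +> (x \<oplus> y)"
  using normal.rcos_sum[of J "add_monoid A" x y] assms
  by (simp add: sb_ideal_def a_r_coset_def set_add_def)

text \<open>Congruence modulo \<open>J\<close> is expressed as equality of cosets, so this lemma and
  its circle analogue allow replacing a term by a congruent one inside a sum or product.\<close>

lemma coset_add_cong:
  assumes "sb_ideal J A" "J +> x = J +> x'" "J +> y = J +> y'"
    and "x \<in> carrier A" "x' \<in> carrier A" "y \<in> carrier A" "y' \<in> carrier A"
  shows "J +> (x \<oplus> y) = J +> (x' \<oplus> y')"
  using assms by (simp flip: coset_add)

lemma coset_circ_cong:
  assumes "sb_ideal J A" "J +> x = J +> x'" "J +> y = J +> y'"
    and "x \<in> carrier A" "x' \<in> carrier A" "y \<in> carrier A" "y' \<in> carrier A"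
  shows "J +> (x \<otimes> y) = J +> (x' \<otimes> y')"
  using assms by (simp flip: coset_circ)

lemma mem_iff_coset_eq:
  assumes "sb_ideal J A" "x \<in> carrier A"
  shows "x \<in> J \<longleftrightarrow> J +> x = J +> \<zero>"
  using coset_eq_iff[OF assms add.one_closed] assms(2) by (simp add: a_minus_def)

lemma add_commutator_mem_iff:
  assumes "sb_ideal J A" "a \<in> carrier A" "b \<in> carrier A"
  shows "add_commutator A a b \<in> J \<longleftrightarrow> J +> (a \<oplus> b) = J +> (b \<oplus> a)"
  using assms
  by (simp add: coset_eq_iff add_commutator_def a_minus_def add.m_assoc add.inv_mult_group)

text \<open>Since \<open>a \<otimes> b = a \<oplus> sb_star A a b \<oplus> b\<close>, the star term
  vanishes modulo \<open>J\<close> exactly when the two operations agree on \<open>a\<close> and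
  \<open>b\<close> there; one cancels \<open>a\<close> on the left and \<open>b\<close> on the
  right.\<close>

lemma sb_star_mem_iff:
  assumes J: "sb_ideal J A" and a: "a \<in> carrier A" and b: "b \<in> carrier A"
  shows "sb_star A a b \<in> J \<longleftrightarrow> J +> (a \<otimes> b) = J +> (a \<oplus> b)"
proof
  assume "sb_star A a b \<in> J"
  then have "J +> sb_star A a b = J +> \<zero>" using J a b by (simp add: mem_iff_coset_eq)
  then have "J +> (a \<oplus> sb_star A a b \<oplus> b) = J +> (a \<oplus> \<zero> \<oplus> b)"
    using J a b by (intro coset_add_cong) auto
  then show "J +> (a \<otimes> b) = J +> (a \<oplus> b)" using a b by (simp add: circ_eq_add_star)
next
  assume "J +> (a \<otimes> b) = J +> (a \<oplus> b)"
  then have "J +> (\<ominus> a \<oplus> a \<otimes> b \<oplus> \<ominus> b) = J +> (\<ominus> a \<oplus> (a \<oplus> b) \<oplus> \<ominus> b)"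
    using J a b by (intro coset_add_cong) auto
  then show "sb_star A a b \<in> J"
    using J a b by (simp add: mem_iff_coset_eq) (simp add: sb_star_def a_minus_def)
qed

text \<open>Membership in \<open>J\<close> is additive, being congruence to \<open>\<zero>\<close>;
  \<open>zero_eq_one\<close> turns it into congruence to the circle identity, after which the
  argument is cancellation of \<open>b \<otimes> a\<close>.\<close>

lemma circ_commutator_mem_iff:
  assumes J: "sb_ideal J A" and a: "a \<in> carrier A" and b: "b \<in> carrier A"
  shows "circ_commutator A a b \<in> J \<longleftrightarrow> J +> (a \<otimes> b) = J +> (b \<otimes> a)"
proof
  assume "circ_commutator A a b \<in> J"
  then have "J +> circ_commutator A a b = J +> \<one>"
    using J a b by (simp add: mem_iff_coset_eq zero_eq_one)
  then have "J +> (circ_commutator A a b \<otimes> (b \<otimes> a)) = J +> (\<one> \<otimes> (b \<otimes> a))"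
    using J a b by (intro coset_circ_cong) auto
  then show "J +> (a \<otimes> b) = J +> (b \<otimes> a)" using a b by (simp add: circ_commutator_circ)
next
  assume "J +> (a \<otimes> b) = J +> (b \<otimes> a)"
  then have "J +> (a \<otimes> b \<otimes> inv (b \<otimes> a)) = J +> (b \<otimes> a \<otimes> inv (b \<otimes> a))"
    using J a b by - (rule coset_circ_cong, auto)
  moreover have "circ_commutator A a b = a \<otimes> b \<otimes> inv (b \<otimes> a)"
    using a b by (simp add: circ_commutator_def inv_mult_group m_assoc)
  ultimately show "circ_commutator A a b \<in> J"
    using J a b by (simp add: mem_iff_coset_eq zero_eq_one)
qed

text \<open>Modulo \<open>J\<close> the element \<open>i\<close> is trivial for both operations, so
  it commutes with \<open>b\<close>. Applied to \<open>I\<close>, this puts the generators of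
  \<open>Ab_commutator A I\<close> inside \<open>I\<close>.\<close>

lemma commutators_mem_ideal:
  assumes J: "sb_ideal J A" and i: "i \<in> J" and b: "b \<in> carrier A"
  shows "add_commutator A i b \<in> J" "sb_star A i b \<in> J" "circ_commutator A i b \<in> J"
proof -
  have ic: "i \<in> carrier A" using sb_ideal_subset[OF J] i by auto
  have i0: "J +> i = J +> \<zero>" using mem_iff_coset_eq[OF J ic] i by simp
  have "J +> (i \<oplus> b) = J +> (\<zero> \<oplus> b)" "J +> (b \<oplus> i) = J +> (b \<oplus> \<zero>)"
    using b ic by (intro coset_add_cong J i0 refl; simp)+
  then show "add_commutator A i b \<in> J" using J ic b by (simp add: add_commutator_mem_iff)
  have "J +> (i \<otimes> b) = J +> (\<one> \<otimes> b)" "J +> (b \<otimes> i) = J +> (b \<otimes> \<one>)"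
    using b ic by (intro coset_circ_cong J i0[unfolded zero_eq_one] refl; simp)+
  then show "circ_commutator A i b \<in> J" using J ic b by (simp add: circ_commutator_mem_iff)
  show "sb_star A i b \<in> J" using J i b by (simp add: sb_ideal_def)
qed

lemma Ab_commutator_least:
  assumes "subgroup H (add_monoid A)"
    and "\<And>i b. i \<in> I \<Longrightarrow> b \<in> carrier A \<Longrightarrow>
      add_commutator A i b \<in> H \<and> sb_star A i b \<in> H \<and> circ_commutator A i b \<in> H"
  shows "Ab_commutator A I \<subseteq> H"
  unfolding Ab_commutator_def using assms by (intro add.generate_subgroup_incl) auto

lemma Ab_commutator_generators:
  assumes "i \<in> I" "b \<in> carrier A"
  shows "add_commutator A i b \<in> Ab_commutator A I" "sb_star A i b \<in> Ab_commutator A I"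
    "circ_commutator A i b \<in> Ab_commutator A I"
  unfolding Ab_commutator_def using assms by (auto intro!: generate.incl)

lemma Ab_commutator_ideal:
  assumes I: "sb_ideal I A"
  shows "sb_ideal (Ab_commutator A I) A"
proof -
  let ?K = "Ab_commutator A I"
  have Ic: "I \<subseteq> carrier A" by (rule sb_ideal_subset[OF I])
  have sub: "subgroup ?K (add_monoid A)"
    unfolding Ab_commutator_def using Ic by (intro add.generate_is_subgroup) auto
  have KI: "?K \<subseteq> I"
    using commutators_mem_ideal[OF I] by (intro Ab_commutator_least sb_ideal_subgroup[OF I]) auto
  have Kc: "x \<in> carrier A" if "x \<in> ?K" for x using KI Ic that by auto
  have gen: "add_commutator A x a \<in> ?K" "sb_star A x a \<in> ?K" "circ_commutator A x a \<in> ?K"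
    if "x \<in> ?K" "a \<in> carrier A" for x a
    using Ab_commutator_generators that KI by auto
  have add: "x \<oplus> y \<in> ?K" if "x \<in> ?K" "y \<in> ?K" for x y
    using subgroup.m_closed[OF sub] that by simp
  have neg: "\<ominus> x \<in> ?K" if "x \<in> ?K" for x
    using subgroup.m_inv_closed[OF sub that] by (simp add: a_inv_def)
  have conj: "a \<oplus> x \<oplus> \<ominus> a \<in> ?K" if x: "x \<in> ?K" and a: "a \<in> carrier A" for a x
  proof -
    \<comment> \<open>The negated commutator is \<open>a \<oplus> x \<ominus> a \<ominus> x\<close>,
      so it differs from the conjugate only by the final \<open>\<ominus> x\<close>.\<close>
    have "a \<oplus> x \<oplus> \<ominus> a = \<ominus> add_commutator A x a \<oplus> x"
      using a Kc[OF x] by (simp add: add_commutator_def a_minus_def add.inv_mult_group add.m_assoc)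
    then show ?thesis using add[OF neg[OF gen(1)[OF x a]] x] by simp
  qed
  have star: "sb_star A a x \<in> ?K" if x: "x \<in> ?K" and a: "a \<in> carrier A" for a x
  proof -
    define y where "y = a \<otimes> x"
    define c where "c = circ_commutator A x a"
    \<comment> \<open>Chosen so that \<open>y = k \<oplus> c \<otimes> y\<close>. As
      \<open>c \<otimes> y = x \<otimes> a\<close>, this expresses \<open>a \<otimes> x\<close>
      through \<open>x \<otimes> a\<close> with an error term in the subgroup.\<close>
    define k where "k = \<ominus> sb_star A c y \<oplus> \<ominus> c"
    have xc: "x \<in> carrier A" using Kc[OF x] .
    have yc: "y \<in> carrier A" using a xc by (simp add: y_def)
    have cK: "c \<in> ?K" using gen(3)[OF x a] by (simp add: c_def)
    have cc: "c \<in> carrier A" using Kc[OF cK] .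
    have kK: "k \<in> ?K" unfolding k_def by (intro add neg gen cK yc)
    have kc: "k \<in> carrier A" using Kc[OF kK] .
    have "c \<oplus> sb_star A c y \<oplus> y = x \<oplus> sb_star A x a \<oplus> a"
      using circ_commutator_circ[OF xc a] circ_eq_add_star[OF cc yc] circ_eq_add_star[OF xc a]
      by (simp add: c_def y_def)
    moreover have "y = k \<oplus> (c \<oplus> sb_star A c y \<oplus> y)"
      using cc yc by (simp add: k_def add.m_assoc)
    ultimately have y: "y = k \<oplus> (x \<oplus> sb_star A x a \<oplus> a)" by simp
    have "sb_star A a x = \<ominus> a \<oplus> y \<oplus> \<ominus> x" by (simp add: sb_star_def a_minus_def y_def)
    \<comment> \<open>After substituting for \<open>y\<close>, the sum is regrouped into conjugates
      by \<open>\<ominus> a\<close> of elements of \<open>?K\<close>, followed by a commutator term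
      that moves \<open>x\<close> past \<open>\<ominus> a\<close> to cancel the trailing
      \<open>\<ominus> x\<close>.\<close>
    also have "\<dots> = (\<ominus> a \<oplus> k \<oplus> \<ominus> (\<ominus> a)) \<oplus>
        (\<ominus> a \<oplus> (x \<oplus> sb_star A x a \<oplus> \<ominus> x) \<oplus> \<ominus> (\<ominus> a)) \<oplus> \<ominus> add_commutator A x (\<ominus> a)"
      unfolding y using xc a kc
      by (simp add: add_commutator_def a_minus_def add.inv_mult_group add.m_assoc)
    also have "\<dots> \<in> ?K" using kK x a xc by (intro add neg conj gen) auto
    finally show ?thesis .
  qed
  have "?K \<lhd> add_monoid A"
    unfolding add.normal_inv_iff using sub conj by auto
  then show ?thesis unfolding sb_ideal_def using star gen by auto
qed

lemma Huq_central_Ab_commutator: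
  assumes I: "sb_ideal I A"
  shows "Huq_central A I (Ab_commutator A I)"
proof -
  let ?K = "Ab_commutator A I"
  note K = Ab_commutator_ideal[OF I]
  have Ic: "i \<in> carrier A" if "i \<in> I" for i using sb_ideal_subset[OF I] that by auto
  have comm: "?K +> (i \<oplus> a) = ?K +> (a \<oplus> i)" and circ: "?K +> (i \<otimes> a) = ?K +> (i \<oplus> a)"
    and circ_comm: "?K +> (i \<otimes> a) = ?K +> (a \<otimes> i)" if "i \<in> I" "a \<in> carrier A" for i a
    using Ab_commutator_generators[OF that] that(2) Ic[OF that(1)] K
    by (simp_all add: add_commutator_mem_iff sb_star_mem_iff circ_commutator_mem_iff)
  have "?K +> (i \<oplus> j \<oplus> (a \<oplus> b)) = ?K +> ((i \<oplus> a) \<oplus> (j \<oplus> b))"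
    and "?K +> (i \<otimes> j \<oplus> a \<otimes> b) = ?K +> ((i \<oplus> a) \<otimes> (j \<oplus> b))"
    if i: "i \<in> I" and j: "j \<in> I" and a: "a \<in> carrier A" and b: "b \<in> carrier A" for i j a b
  proof -
    note cl = Ic[OF i] Ic[OF j] a b
    have "?K +> (i \<oplus> ((j \<oplus> a) \<oplus> b)) = ?K +> (i \<oplus> ((a \<oplus> j) \<oplus> b))"
      using cl by (intro coset_add_cong K comm j refl) auto
    then show "?K +> (i \<oplus> j \<oplus> (a \<oplus> b)) = ?K +> ((i \<oplus> a) \<oplus> (j \<oplus> b))"
      using cl by (simp add: add.m_assoc)
    \<comment> \<open>\<open>circ\<close> applies with first argument \<open>i \<otimes> j\<close>,
      because an ideal is closed under the circle operation.\<close>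
    have "?K +> (i \<otimes> j \<oplus> a \<otimes> b) = ?K +> (i \<otimes> j \<otimes> (a \<otimes> b))"
      using cl circ_mem[OF I i j] by (simp add: circ)
    also have "\<dots> = ?K +> (i \<otimes> ((j \<otimes> a) \<otimes> b))" using cl by (simp add: m_assoc)
    also have "\<dots> = ?K +> (i \<otimes> ((a \<otimes> j) \<otimes> b))"
      using cl by (intro coset_circ_cong K circ_comm j refl) auto
    also have "\<dots> = ?K +> ((i \<otimes> a) \<otimes> (j \<otimes> b))" using cl by (simp add: m_assoc)
    also have "\<dots> = ?K +> ((i \<oplus> a) \<otimes> (j \<oplus> b))"
      using cl by (intro coset_circ_cong K circ i j) auto
    finally show "?K +> (i \<otimes> j \<oplus> a \<otimes> b) = ?K +> ((i \<oplus> a) \<otimes> (j \<oplus> b))" .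
  qed
  then show ?thesis
    using K Ic by (subst Huq_central_iff) (auto simp: coset_eq_iff)
qed

lemma Ab_commutator_subset_Huq_central:
  assumes I: "sb_ideal I A" and H: "Huq_central A I J"
  shows "Ab_commutator A I \<subseteq> J"
proof -
  have J: "sb_ideal J A" using H by (simp add: Huq_central_def)
  have Isub: "I \<subseteq> carrier A" by (rule sb_ideal_subset[OF I])
  then have Ic: "i \<in> carrier A" if "i \<in> I" for i using that by auto
  have I0: "\<zero> \<in> I" using subgroup.one_closed[OF sb_ideal_subgroup[OF I]] by simp
  have add: "J +> (i \<oplus> j \<oplus> (a \<oplus> b)) = J +> ((i \<oplus> a) \<oplus> (j \<oplus> b))"
    and circ: "J +> (i \<otimes> j \<oplus> a \<otimes> b) = J +> ((i \<oplus> a) \<otimes> (j \<oplus> b))"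
    if "i \<in> I" "j \<in> I" "a \<in> carrier A" "b \<in> carrier A" for i j a b
    using H that Ic J by (auto simp: Huq_central_iff[OF Isub] coset_eq_iff)
  have zero_circ [simp]: "\<zero> \<otimes> x = x" "x \<otimes> \<zero> = x" if "x \<in> carrier A" for x
    using that by (simp_all add: zero_eq_one)
  show ?thesis
  proof (intro Ab_commutator_least sb_ideal_subgroup[OF J])
    fix i b assume i: "i \<in> I" and b: "b \<in> carrier A"
    note cl = Ic[OF i] b
    \<comment> \<open>The homomorphism condition is tested on the pairs \<open>(i, \<zero>)\<close>
      and \<open>(\<zero>, b)\<close> of the product: first the sum with \<open>(\<zero>, b)\<close>
      on the left, then the circle product in both orders.\<close>
    have "J +> (i \<oplus> b) = J +> (b \<oplus> i)"
      using add[OF I0 i b add.one_closed] cl by simp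
    moreover have "J +> (i \<oplus> b) = J +> (i \<otimes> b)"
      using circ[OF i I0 add.one_closed b] cl by simp
    moreover have "J +> (i \<oplus> b) = J +> (b \<otimes> i)"
      using circ[OF I0 i b add.one_closed] cl by simp
    ultimately show "add_commutator A i b \<in> J \<and> sb_star A i b \<in> J \<and> circ_commutator A i b \<in> J"
      using J cl by (simp add: add_commutator_mem_iff sb_star_mem_iff circ_commutator_mem_iff)
  qed
qed

end

theorem proposition5p5:
  fixes A :: "('a, 'm) ring_scheme" and I :: "'a set"
  assumes "skew_brace A" and "sb_ideal I A"
  shows "Huq_commutator A I = Ab_commutator A I"
proof -
  interpret skew_brace A by fact
  note I = \<open>sb_ideal I A\<close>
  show ?thesis
    using Huq_commutator_least(2)[OF I Huq_central_Ab_commutator[OF I]]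
      Ab_commutator_subset_Huq_central[OF I Huq_commutator_least(1)[OF I]] by (rule antisym)
qed

end
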